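(* Let $A\in\mathbb{R}^{n\times n}$ be a singular, irreducible M-matrix, with left and right eigenvectors $z_\ell\ne0$, $z_r\neq0$ for the eigenvalue $0$ (i.e. $z_\ell^TA=0$ and $Az_r=0$). Let $v,w\in\mathbb{R}^n$ with $v\ge0$, $w\ge0$ and $(z_\ell^Tv)(w^Tz_r)\neq0$. Then $A+vw^T$ is a P-matrix, i.e. all its principal minors are positive.
   Context: For a vector or matrix, $\ge0$ means that all entries are nonnegative. An M-matrix is a matrix $\gamma I-P$ with $P\ge0$ and $\gamma\ge\rho(P)$, where $\rho$ denotes the spectral radius; it is a singular M-matrix if $\gamma=\rho(P)$. *)

theory Defs
  imports
    "HOL-Combinatorics.Permutations"
    "Jordan_Normal_Form.Spectral_Radius"
    "Jordan_Normal_Form.DL_Submatrix"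
begin

text \<open>The order on vectors and matrices is the entrywise one (between objects of equal
  dimension), so \<open>0\<^sub>m n n \<le> P\<close> is entrywise nonnegativity. The spectral radius of a real
  matrix refers to its complex spectrum.\<close>

definition M_matrix_rep :: "nat \<Rightarrow> real mat \<Rightarrow> real \<Rightarrow> real mat \<Rightarrow> bool" where
  "M_matrix_rep n A \<gamma> P \<longleftrightarrow>
     P \<in> carrier_mat n n \<and> 0\<^sub>m n n \<le> P \<and>
     \<gamma> \<ge> spectral_radius (map_mat complex_of_real P) \<and>
     A = \<gamma> \<cdot>\<^sub>m 1\<^sub>m n - P"

definition M_matrix :: "nat \<Rightarrow> real mat \<Rightarrow> bool" where
  "M_matrix n A \<longleftrightarrow> (\<exists>\<gamma> P. M_matrix_rep n A \<gamma> P)"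

definition singular_M_matrix :: "nat \<Rightarrow> real mat \<Rightarrow> bool" where
  "singular_M_matrix n A \<longleftrightarrow>
     (\<exists>\<gamma> P. M_matrix_rep n A \<gamma> P \<and> \<gamma> = spectral_radius (map_mat complex_of_real P))"

text \<open>A matrix is reducible if a simultaneous permutation \<open>p\<close> of rows and columns brings it into
  block upper triangular form with square diagonal blocks of sizes \<open>k\<close> and \<open>n - k\<close>, both
  positive. In particular every \<open>1 \<times> 1\<close> matrix, including the zero matrix, is irreducible.\<close>

definition reducible_mat :: "nat \<Rightarrow> 'a :: zero mat \<Rightarrow> bool" where
  "reducible_mat n A \<longleftrightarrow>
     (\<exists>p k. p permutes {..<n} \<and> 0 < k \<and> k < n \<and>
        (\<forall>i\<in>{k..<n}. \<forall>j\<in>{..<k}. A $$ (p i, p j) = 0))"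

definition irreducible_mat :: "nat \<Rightarrow> 'a :: zero mat \<Rightarrow> bool" where
  "irreducible_mat n A \<longleftrightarrow> \<not> reducible_mat n A"

definition outer_prod :: "'a :: times vec \<Rightarrow> 'a vec \<Rightarrow> 'a mat" where
  "outer_prod v w = mat (dim_vec v) (dim_vec w) (\<lambda>(i, j). v $ i * w $ j)"

definition P_matrix :: "nat \<Rightarrow> real mat \<Rightarrow> bool" where
  "P_matrix n A \<longleftrightarrow>
     A \<in> carrier_mat n n \<and> (\<forall>I. I \<subseteq> {..<n} \<and> I \<noteq> {} \<longrightarrow> det (submatrix A I I) > 0)"

end

theory Submission
  imports Defs
begin

text \<open>Write \<open>A = \<gamma> I - P\<close>. The vector \<open>x = \<bar>z\<^sub>r\<bar>\<close> satisfies \<open>P x \<ge> \<gamma> x\<close>. If this were not an equality,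
  irreducibility would give \<open>c \<ge> 0\<close> and \<open>r > \<gamma>\<close> with \<open>P c \<ge> r c \<noteq> 0\<close>, so the powers of \<open>P\<close> would
  grow faster than \<open>\<gamma> = \<rho>(P)\<close> allows. Hence \<open>P x = \<gamma> x\<close>, and \<open>x > 0\<close> by irreducibility.

  Let \<open>B\<close> be the principal submatrix of \<open>A + v w\<^sup>T\<close> indexed by \<open>I\<close>. It suffices that \<open>B\<close> has no real
  eigenvalue \<open>k \<le> 0\<close>: then the characteristic polynomial of \<open>- B\<close> has no root in \<open>[0, \<infinity>)\<close> and is
  therefore positive at \<open>0\<close>, where its value is \<open>det B\<close>. So let \<open>B u = k u\<close> with \<open>k \<le> 0\<close>.
  If \<open>w\<^sup>T u \<le> 0\<close> then \<open>A[I] u - k u = - (w\<^sup>T u) v \<ge> 0\<close> on \<open>I\<close>, and comparing \<open>u\<close> with multiples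
  of \<open>x\<close> (a minimum principle) gives \<open>u \<ge> 0\<close>. Hence \<open>w\<^sup>T u = 0\<close>, and the same argument for \<open>- u\<close>
  gives \<open>u = 0\<close>. The case \<open>w\<^sup>T u \<ge> 0\<close> is symmetric.\<close>

section \<open>Perron-Frobenius theory for irreducible nonnegative matrices\<close>

text \<open>Draw an arc from \<open>i\<close> to \<open>j\<close> whenever \<open>p i j\<close> is
  nonzero. The last assumption encodes strong connectivity of this digraph: no nonempty proper
  subset of \<open>N\<close> is closed under following arcs.\<close>

locale irreducible_nonneg =
  fixes N :: "'a set" and p :: "'a \<Rightarrow> 'a \<Rightarrow> real"
  assumes finite_N: "finite N"
    and nonneg: "i \<in> N \<Longrightarrow> j \<in> N \<Longrightarrow> 0 \<le> p i j"
    and irreducible: "Z \<subseteq> N \<Longrightarrow> Z \<noteq> {} \<Longrightarrow>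
      (\<And>i j. i \<in> Z \<Longrightarrow> j \<in> N \<Longrightarrow> p i j \<noteq> 0 \<Longrightarrow> j \<in> Z) \<Longrightarrow> Z = N"
begin

text \<open>With \<open>d = p b - \<gamma> b\<close>, replacing \<open>b\<close> by \<open>b + d / (\<gamma> + 1)\<close> turns \<open>d\<close> into
  \<open>(d + p d) / (\<gamma> + 1)\<close>, which has strictly fewer zeros by irreducibility.\<close>

lemma subinvariant_imp_strictly_subinvariant:
  assumes "0 \<le> \<gamma>"
    and "\<And>i. i \<in> N \<Longrightarrow> 0 \<le> b i"
    and "\<And>i. i \<in> N \<Longrightarrow> \<gamma> * b i \<le> (\<Sum>j\<in>N. p i j * b j)"
    and "\<exists>i\<in>N. \<gamma> * b i \<noteq> (\<Sum>j\<in>N. p i j * b j)"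
  shows "\<exists>c. \<forall>i\<in>N. 0 \<le> c i \<and> \<gamma> * c i < (\<Sum>j\<in>N. p i j * c j)"
  using assms(2-)
proof (induction "card {i \<in> N. \<gamma> * b i = (\<Sum>j\<in>N. p i j * b j)}" arbitrary: b rule: less_induct)
  case less
  define d where "d i = (\<Sum>j\<in>N. p i j * b j) - \<gamma> * b i" for i
  define e where "e = 1 / (\<gamma> + 1)"
  define b' where "b' i = b i + e * d i" for i
  define Z where "Z = {i \<in> N. \<gamma> * b i = (\<Sum>j\<in>N. p i j * b j)}"
  define Z' where "Z' = {i \<in> N. \<gamma> * b' i = (\<Sum>j\<in>N. p i j * b' j)}"
  have e: "0 < e" "1 - e * \<gamma> = e" using assms(1) by (simp_all add: e_def field_simps)
  have d: "0 \<le> d i" if "i \<in> N" for i using less.prems(2)[OF that] by (simp add: d_def)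
  have dZ: "d i = 0 \<longleftrightarrow> i \<in> Z" if "i \<in> N" for i using that by (auto simp: d_def Z_def)
  have pd: "0 \<le> p i j * d j" if "i \<in> N" "j \<in> N" for i j using that d nonneg by simp
  have d': "(\<Sum>j\<in>N. p i j * b' j) - \<gamma> * b' i = e * (d i + (\<Sum>j\<in>N. p i j * d j))" for i
  proof -
    have "(\<Sum>j\<in>N. p i j * b' j) = (\<Sum>j\<in>N. p i j * b j) + e * (\<Sum>j\<in>N. p i j * d j)"
      by (simp add: b'_def algebra_simps sum.distrib sum_distrib_left)
    then have "(\<Sum>j\<in>N. p i j * b' j) - \<gamma> * b' i = (1 - e * \<gamma>) * d i + e * (\<Sum>j\<in>N. p i j * d j)"
      by (simp add: b'_def d_def algebra_simps)
    then show ?thesis unfolding e(2) by (simp add: algebra_simps)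
  qed
  have b'0: "0 \<le> b' i" if "i \<in> N" for i using less.prems(1)[OF that] d[OF that] e by (simp add: b'_def)
  have s0: "0 \<le> (\<Sum>j\<in>N. p i j * d j)" if "i \<in> N" for i using pd that by (simp add: sum_nonneg)
  have b'1: "\<gamma> * b' i \<le> (\<Sum>j\<in>N. p i j * b' j)" if "i \<in> N" for i
    using d'[of i] d[OF that] s0[OF that] e(1) by (smt (verit) mult_nonneg_nonneg)
  \<comment> \<open>A zero of the new defect is a zero of \<open>d i + (p d) i\<close>, whose
    summands are nonnegative. So \<open>d\<close> vanishes at \<open>i\<close> and at all its
    successors.\<close>
  have Z'D: "i \<in> Z \<and> (\<forall>j\<in>N. p i j \<noteq> 0 \<longrightarrow> j \<in> Z)" if "i \<in> Z'" for i
  proof -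
    from that have i: "i \<in> N" and "d i + (\<Sum>j\<in>N. p i j * d j) = 0"
      using d'[of i] e(1) by (auto simp: Z'_def)
    with d[OF i] s0[OF i] have 0: "d i = 0" "(\<Sum>j\<in>N. p i j * d j) = 0" by linarith+
    from 0(2) have "\<forall>j\<in>N. p i j * d j = 0"
      using sum_nonneg_eq_0_iff[OF finite_N, of "\<lambda>j. p i j * d j"] pd[OF i] by blast
    with 0(1) i dZ show ?thesis by auto
  qed
  have ZN: "Z \<subseteq> N" "Z \<noteq> N" using less.prems(3) by (auto simp: Z_def)
  show ?case
  proof (cases "Z' = {}")
    case True
    then have "\<forall>i\<in>N. 0 \<le> b' i \<and> \<gamma> * b' i < (\<Sum>j\<in>N. p i j * b' j)"
      using b'0 b'1 by (force simp: Z'_def)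
    then show ?thesis by blast
  next
    case False
    \<comment> \<open>If \<open>Z'\<close> were equal to \<open>Z\<close>, then \<open>Z\<close>
      would be closed under successors and hence all of \<open>N\<close>, but \<open>b\<close> has a
      nonzero defect somewhere.\<close>
    have "Z' \<noteq> Z" using irreducible[of Z] ZN False Z'D by blast
    then have "Z' \<subset> Z" using Z'D by blast
    moreover have "finite Z" using ZN finite_N finite_subset by blast
    ultimately have "card Z' < card Z" by (rule psubset_card_mono[rotated])
    moreover have "\<exists>i\<in>N. \<gamma> * b' i \<noteq> (\<Sum>j\<in>N. p i j * b' j)"
      using \<open>Z' \<subset> Z\<close> ZN by (auto simp: Z'_def)
    ultimately show ?thesis
      using less.hyps[of b'] b'0 b'1 unfolding Z_def Z'_def by blast
  qed
qed

text \<open>The assumption \<open>maximal\<close> states what is needed of a spectral radius without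
  mentioning spectra. A failure of invariance would yield a strictly subinvariant \<open>c\<close>,
  whose slack on the finite set \<open>N\<close> allows a factor larger than \<gamma>.\<close>

lemma subinvariant_imp_positive_invariant:
  assumes "0 \<le> \<gamma>"
    and b: "\<And>i. i \<in> N \<Longrightarrow> 0 \<le> b i" "\<exists>i\<in>N. b i \<noteq> 0"
    and sub: "\<And>i. i \<in> N \<Longrightarrow> \<gamma> * b i \<le> (\<Sum>j\<in>N. p i j * b j)"
    and maximal: "\<And>c r. \<lbrakk>\<And>i. i \<in> N \<Longrightarrow> 0 \<le> c i; \<exists>i\<in>N. 0 < c i;
      \<And>i. i \<in> N \<Longrightarrow> r * c i \<le> (\<Sum>j\<in>N. p i j * c j)\<rbrakk> \<Longrightarrow> r \<le> \<gamma>"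
  shows "\<And>i. i \<in> N \<Longrightarrow> 0 < b i" and "\<And>i. i \<in> N \<Longrightarrow> (\<Sum>j\<in>N. p i j * b j) = \<gamma> * b i"
proof -
  have inv: "(\<Sum>j\<in>N. p i j * b j) = \<gamma> * b i" if "i \<in> N" for i
  proof (rule ccontr)
    assume "\<not> ?thesis"
    with that have "\<exists>i\<in>N. \<gamma> * b i \<noteq> (\<Sum>j\<in>N. p i j * b j)" by force
    from subinvariant_imp_strictly_subinvariant[OF assms(1) b(1) sub this]
    obtain c where c: "\<And>i. i \<in> N \<Longrightarrow> 0 \<le> c i" "\<And>i. i \<in> N \<Longrightarrow> \<gamma> * c i < (\<Sum>j\<in>N. p i j * c j)"
      by blast
    define d where "d i = (\<Sum>j\<in>N. p i j * c j) - \<gamma> * c i" for i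
    \<comment> \<open>The factor can be raised by \<open>\<delta> / M\<close>: \<delta> is the least
      slack, and \<open>M\<close> bounds \<open>c\<close> from above, the added 1 making it
      positive.\<close>
    define \<delta> where "\<delta> = Min (d ` N)"
    define M where "M = Max (c ` N) + 1"
    have N: "d ` N \<noteq> {}" "finite (d ` N)" "finite (c ` N)" using that finite_N by auto
    have "0 < \<delta>" using c(2) N by (auto simp: \<delta>_def d_def)
    have \<delta>: "\<delta> \<le> d i" if "i \<in> N" for i using that N by (simp add: \<delta>_def)
    have M: "c i \<le> M" if "i \<in> N" for i
      using Max_ge[OF N(3), of "c i"] that by (simp add: M_def)
    have "0 < M" using Max_ge[OF N(3), of "c i"] c(1)[OF that] that by (simp add: M_def)
    have "\<exists>i\<in>N. 0 < c i"
    proof (rule ccontr)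
      assume "\<not> ?thesis"
      with c(1) have "\<forall>i\<in>N. c i = 0" by force
      with c(2)[OF that] that show False by simp
    qed
    moreover have "(\<gamma> + \<delta> / M) * c i \<le> (\<Sum>j\<in>N. p i j * c j)" if "i \<in> N" for i
    proof -
      have "\<delta> / M * c i \<le> \<delta> / M * M"
        using M[OF that] \<open>0 < \<delta>\<close> \<open>0 < M\<close> by (intro mult_left_mono) auto
      also have "\<dots> \<le> d i" using \<delta>[OF that] \<open>0 < M\<close> by simp
      finally show ?thesis by (simp add: d_def algebra_simps)
    qed
    ultimately have "\<gamma> + \<delta> / M \<le> \<gamma>" using c(1) by (intro maximal)
    with \<open>0 < \<delta>\<close> \<open>0 < M\<close> show False by (simp add: field_simps)
  qed
  then show "\<And>i. i \<in> N \<Longrightarrow> (\<Sum>j\<in>N. p i j * b j) = \<gamma> * b i" .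
  \<comment> \<open>Where \<open>b\<close> vanishes, invariance makes a sum of nonnegative terms
    zero, so \<open>b\<close> vanishes at all successors too. The zero set is thus closed.\<close>
  define Z where "Z = {i \<in> N. b i = 0}"
  have "j \<in> Z" if "i \<in> Z" "j \<in> N" "p i j \<noteq> 0" for i j
  proof -
    from that have i: "i \<in> N" and "(\<Sum>j\<in>N. p i j * b j) = 0" using inv by (auto simp: Z_def)
    then have "\<forall>j\<in>N. p i j * b j = 0"
      using sum_nonneg_eq_0_iff[OF finite_N, of "\<lambda>j. p i j * b j"] b(1) nonneg by auto
    with that show ?thesis by (auto simp: Z_def)
  qed
  moreover have "Z \<noteq> N" "Z \<subseteq> N" using b(2) by (auto simp: Z_def)
  ultimately have "Z = {}" using irreducible by blast
  then show "\<And>i. i \<in> N \<Longrightarrow> 0 < b i" using b(1) by (force simp: Z_def)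
qed

section \<open>Supersolutions and rank-one perturbations on a subset of the indices\<close>

context
  fixes x :: "'a \<Rightarrow> real" and \<gamma> k :: real and I :: "'a set"
  assumes x: "\<And>i. i \<in> N \<Longrightarrow> 0 < x i"
    and super: "\<And>i. i \<in> N \<Longrightarrow> (\<Sum>j\<in>N. p i j * x j) \<le> \<gamma> * x i"
    and I: "I \<subseteq> N" and k: "k \<le> 0"
begin

text \<open>Let \<open>m\<close> be the least ratio \<open>u i / x i\<close>. The set where it is
  attained is closed under successors, even those outside \<open>I\<close>, so it is all of
  \<open>N\<close>.\<close>

lemma minimum_principle:
  assumes u: "\<And>i. i \<in> I \<Longrightarrow> (\<Sum>j\<in>I. p i j * u j) \<le> (\<gamma> - k) * u i"
    and neg: "\<exists>i\<in>I. u i < 0"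
  shows "I = N" and "\<exists>m<0. \<forall>i\<in>N. u i = m * x i"
proof -
  have fin: "finite I" using I finite_N finite_subset by blast
  define m where "m = Min ((\<lambda>i. u i / x i) ` I)"
  \<comment> \<open>This is \<open>u\<close>, extended by zero outside \<open>I\<close>, minus
    \<open>m * x\<close>. It is nonnegative, and strictly positive outside \<open>I\<close> because
    \<open>m < 0\<close>.\<close>
  define y where "y j = (if j \<in> I then u j - m * x j else - m * x j)" for j
  define Z where "Z = {i \<in> I. u i = m * x i}"
  obtain i0 where i0: "i0 \<in> I" "u i0 < 0" using neg by blast
  have m_le: "m \<le> u i / x i" if "i \<in> I" for i using that fin by (simp add: m_def)
  have xI: "0 < x i" if "i \<in> I" for i using that x I by blast
  have "m < 0" using m_le[OF i0(1)] i0 xI by (meson divide_neg_pos le_less_trans)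
  have y0: "0 \<le> y j" if "j \<in> N" for j
    using m_le[of j] xI[of j] x[OF that] \<open>m < 0\<close> mult_neg_pos[of m "x j"]
    by (auto simp: y_def field_simps)
  have "m \<in> (\<lambda>i. u i / x i) ` I" unfolding m_def using fin i0 by (intro Min_in) auto
  then have "Z \<noteq> {}" using xI by (auto simp: Z_def) (metis less_irrefl nonzero_eq_divide_eq)
  moreover have "j \<in> Z" if "i \<in> Z" "j \<in> N" "p i j \<noteq> 0" for i j
  proof -
    from that I have i: "i \<in> I" "i \<in> N" "u i = m * x i" by (auto simp: Z_def)
    have "(\<Sum>j\<in>N. p i j * y j) = (\<Sum>j\<in>N. (if j \<in> I then p i j * u j else 0) - m * (p i j * x j))"
      by (intro sum.cong) (auto simp: y_def algebra_simps)
    also have "\<dots> = (\<Sum>j\<in>I. p i j * u j) - m * (\<Sum>j\<in>N. p i j * x j)"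
      using I finite_N
      by (simp add: sum_subtractf sum_distrib_left sum.If_cases Int_absorb1)
    also have "\<dots> \<le> (\<gamma> - k) * u i - m * (\<gamma> * x i)"
      using u[OF i(1)] mult_left_mono_neg[OF super[OF i(2)], of m] \<open>m < 0\<close> by linarith
    also have "\<dots> = (- k) * (m * x i)" using i by (simp add: algebra_simps)
    also have "\<dots> \<le> 0" using k \<open>m < 0\<close> x[OF i(2)]
      by (intro mult_nonneg_nonpos[of "- k"]) (auto intro: less_imp_le mult_neg_pos)
    finally have "(\<Sum>j\<in>N. p i j * y j) \<le> 0" .
    then have "(\<Sum>j\<in>N. p i j * y j) = 0"
      using sum_nonneg[of N "\<lambda>j. p i j * y j"] y0 nonneg i(2) by force
    then have "\<forall>j\<in>N. p i j * y j = 0"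
      using sum_nonneg_eq_0_iff[OF finite_N, of "\<lambda>j. p i j * y j"] y0 nonneg i(2) by auto
    then have "y j = 0" using that by auto
    \<comment> \<open>A zero of \<open>y\<close> cannot lie outside \<open>I\<close>, and inside
      \<open>I\<close> it is a point where the minimal ratio is attained.\<close>
    then show ?thesis using \<open>m < 0\<close> x[OF that(2)] by (auto simp: y_def Z_def split: if_splits)
  qed
  moreover have "Z \<subseteq> N" using I by (auto simp: Z_def)
  ultimately have "Z = N" by (intro irreducible)
  then show "I = N" "\<exists>m<0. \<forall>i\<in>N. u i = m * x i" using I \<open>m < 0\<close> by (auto simp: Z_def)
qed

text \<open>The sign of the sum over \<open>w\<close> makes \<open>u\<close> a supersolution. A
  negative entry would force \<open>I = N\<close> and \<open>u = m * x\<close> with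
  \<open>m < 0\<close>, the extreme case of the minimum principle. Then the sum is strictly
  negative, while the equation bounds its product with \<open>v i\<close> below by
  \<open>k * u i \<ge> 0\<close>, so \<open>v\<close> would vanish.\<close>

lemma rank_one_perturbation_nonneg:
  assumes v: "\<And>i. i \<in> N \<Longrightarrow> 0 \<le> v i" "\<exists>i\<in>N. v i \<noteq> 0"
    and w: "\<And>i. i \<in> N \<Longrightarrow> 0 \<le> w i" "\<exists>i\<in>N. w i \<noteq> 0"
    and u: "\<And>i. i \<in> I \<Longrightarrow>
      \<gamma> * u i - (\<Sum>j\<in>I. p i j * u j) + v i * (\<Sum>j\<in>I. w j * u j) = k * u i"
    and le: "(\<Sum>j\<in>I. w j * u j) \<le> 0"
    and i: "i \<in> I"
  shows "0 \<le> u i"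
proof (rule ccontr)
  assume "\<not> ?thesis"
  with i have neg: "\<exists>i\<in>I. u i < 0" by force
  have u': "(\<Sum>j\<in>I. p i j * u j) \<le> (\<gamma> - k) * u i" if "i \<in> I" for i
    using u[OF that] mult_nonneg_nonpos[OF v(1) le, of i] that I by (auto simp: algebra_simps)
  note mp = minimum_principle[OF u' neg]
  from mp(1) have IN: "I = N" by simp
  from mp(2) obtain m where m: "m < 0" "\<And>i. i \<in> N \<Longrightarrow> u i = m * x i" by blast
  have "(\<Sum>j\<in>I. w j * u j) = m * (\<Sum>j\<in>N. w j * x j)"
    unfolding IN sum_distrib_left by (intro sum.cong) (auto simp: m(2))
  moreover have "0 < (\<Sum>j\<in>N. w j * x j)"
  proof -
    obtain j where j: "j \<in> N" "w j \<noteq> 0" using w(2) by blast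
    show ?thesis
      using w(1) x j by (intro sum_pos2[OF finite_N j(1)]) (auto simp: less_le)
  qed
  ultimately have neg': "(\<Sum>j\<in>I. w j * u j) < 0" using m(1) by (simp add: mult_neg_pos)
  have "v i = 0" if "i \<in> N" for i
  proof -
    have "(\<Sum>j\<in>I. p i j * u j) = m * (\<Sum>j\<in>N. p i j * x j)"
      unfolding IN sum_distrib_left by (intro sum.cong) (auto simp: m(2))
    also have "\<dots> \<ge> m * (\<gamma> * x i)" using super[OF that] m(1) by (intro mult_left_mono_neg) auto
    finally have "v i * (\<Sum>j\<in>I. w j * u j) \<ge> k * u i"
      using u[of i] that IN m(2)[OF that] by (simp add: algebra_simps)
    moreover have "0 \<le> k * u i"
      using k m(1) x[OF that] by (simp add: m(2)[OF that] mult_nonpos_nonpos mult_nonpos_nonneg)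
    ultimately have "0 \<le> v i * (\<Sum>j\<in>I. w j * u j)" by linarith
    with neg' v(1)[OF that] show ?thesis by (simp add: zero_le_mult_iff)
  qed
  with v(2) show False by blast
qed

lemma rank_one_perturbation_eq_0:
  assumes v: "\<And>i. i \<in> N \<Longrightarrow> 0 \<le> v i" "\<exists>i\<in>N. v i \<noteq> 0"
    and w: "\<And>i. i \<in> N \<Longrightarrow> 0 \<le> w i" "\<exists>i\<in>N. w i \<noteq> 0"
    and u: "\<And>i. i \<in> I \<Longrightarrow>
      \<gamma> * u i - (\<Sum>j\<in>I. p i j * u j) + v i * (\<Sum>j\<in>I. w j * u j) = k * u i"
    and i: "i \<in> I"
  shows "u i = 0"
proof -
  have u': "\<gamma> * (- u i) - (\<Sum>j\<in>I. p i j * (- u j)) + v i * (\<Sum>j\<in>I. w j * (- u j)) = k * (- u i)"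
    if "i \<in> I" for i
    using u[OF that] by (simp add: sum_negf)
  have pos: "0 \<le> u i" if "(\<Sum>j\<in>I. w j * u j) \<le> 0" "i \<in> I" for i
    using rank_one_perturbation_nonneg[OF v w u that] by simp
  have neg: "u i \<le> 0" if "(\<Sum>j\<in>I. w j * u j) \<ge> 0" "i \<in> I" for i
    using rank_one_perturbation_nonneg[OF v w u', of i] that by (simp add: sum_negf)
  have "(\<Sum>j\<in>I. w j * u j) = 0"
  proof (cases "(\<Sum>j\<in>I. w j * u j) \<le> 0")
    case True
    then have "0 \<le> (\<Sum>j\<in>I. w j * u j)" using pos w(1) I by (intro sum_nonneg) auto
    with True show ?thesis by simp
  next
    case False
    then have "(\<Sum>j\<in>I. w j * u j) \<le> 0"
      using neg w(1) I by (intro sum_nonpos mult_nonneg_nonpos) auto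
    with False show ?thesis by simp
  qed
  with pos neg i show ?thesis by (simp add: antisym)
qed

end

end

section \<open>Matrix facts: reducibility, positive determinants, spectral radius\<close>

lemma irreducible_mat_closed_set:
  assumes irr: "irreducible_mat n A"
    and Z: "Z \<subseteq> {..<n}" "Z \<noteq> {}"
    and closed: "\<And>i j. \<lbrakk>i \<in> Z; j < n; j \<notin> Z\<rbrakk> \<Longrightarrow> A $$ (i, j) = 0"
  shows "Z = {..<n}"
proof (rule ccontr)
  assume ne: "Z \<noteq> {..<n}"
  define Y where "Y = {..<n} - Z"
  define k where "k = card Y"
  have fin: "finite Y" "finite Z" using Z finite_subset by (auto simp: Y_def)
  have "card Y + card Z = n"
    using card_Diff_subset[OF fin(2) Z(1)] card_mono[OF _ Z(1)] by (simp add: Y_def)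
  moreover have "0 < card Y" "0 < card Z" using fin Z ne by (auto simp: Y_def card_gt_0_iff)
  ultimately have k: "0 < k" "k < n" "card Z = card {k..<n}" by (auto simp: k_def)
  obtain f where f: "bij_betw f {..<k} Y"
    using finite_same_card_bij[of "{..<k}" Y] fin by (auto simp: k_def)
  obtain g where g: "bij_betw g {k..<n} Z"
    using finite_same_card_bij[of "{k..<n}" Z] fin k by auto
  \<comment> \<open>The complement \<open>Y\<close> is enumerated before \<open>Z\<close>, so the
    zero entries with row in \<open>Z\<close> and column in \<open>Y\<close> fill the lower left
    block, as in \<open>reducible_mat\<close>.\<close>
  define p where "p i = (if i < k then f i else if i < n then g i else i)" for i
  have pf: "bij_betw p {..<k} Y" using f by (subst bij_betw_cong[of _ p f]) (auto simp: p_def)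
  have pg: "bij_betw p {k..<n} Z" using g by (subst bij_betw_cong[of _ p g]) (auto simp: p_def)
  have "bij_betw p ({..<k} \<union> {k..<n}) (Y \<union> Z)"
    by (rule bij_betw_combine[OF pf pg]) (auto simp: Y_def)
  moreover have "{..<k} \<union> {k..<n} = {..<n}" "Y \<union> Z = {..<n}" using k Z by (auto simp: Y_def)
  ultimately have "bij_betw p {..<n} {..<n}" by simp
  then have "p permutes {..<n}" using k by (intro bij_imp_permutes) (auto simp: p_def)
  moreover have "A $$ (p i, p j) = 0" if "i \<in> {k..<n}" "j \<in> {..<k}" for i j
  proof -
    have "p i \<in> Z" "p j \<in> Y" using that pf pg by (auto dest: bij_betwE)
    then show ?thesis by (intro closed) (auto simp: Y_def)
  qed
  ultimately have "reducible_mat n A"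
    unfolding reducible_mat_def using k by (intro exI[of _ p] exI[of _ k]) auto
  with irr show False by (simp add: irreducible_mat_def)
qed

lemma det_pos_if_real_eigenvalues_pos:
  fixes B :: "real mat"
  assumes B: "B \<in> carrier_mat n n" and pos: "\<And>k. eigenvalue B k \<Longrightarrow> 0 < k"
  shows "0 < det B"
proof (rule ccontr)
  assume "\<not> ?thesis"
  define q where "q = char_poly (- B)"
  have mB: "- B \<in> carrier_mat n n" using B by simp
  \<comment> \<open>Passing to \<open>- B\<close> avoids the sign \<open>(-1)^n\<close>: evaluating
    \<open>det (s I + B)\<close> at 0 gives \<open>det B\<close> itself.\<close>
  have q0: "poly q 0 = det B"
    unfolding q_def char_poly_matrix[OF mB]
    by (rule arg_cong[of _ _ det], rule eq_matI) (use B in \<open>auto simp: char_matrix_def\<close>)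
  have no_root: "poly q s \<noteq> 0" if "0 \<le> s" for s
  proof
    assume "poly q s = 0"
    then obtain u where u: "u \<in> carrier_vec n" "u \<noteq> 0\<^sub>v n" "(- B) *\<^sub>v u = s \<cdot>\<^sub>v u"
      unfolding q_def eigenvalue_root_char_poly[OF mB, symmetric] eigenvalue_def eigenvector_def
      using B by auto
    from u(3) have "- (B *\<^sub>v u) = s \<cdot>\<^sub>v u" using B u(1) by simp
    then have "B *\<^sub>v u = - (s \<cdot>\<^sub>v u)" by (metis uminus_uminus_vec)
    then have "B *\<^sub>v u = (- s) \<cdot>\<^sub>v u" by auto
    then have "eigenvalue B (- s)" using u B by (auto simp: eigenvalue_def eigenvector_def)
    with pos that show False by force
  qed
  \<comment> \<open>Being monic, \<open>q\<close> is eventually positive, so a negative value at 0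
    would produce a positive root.\<close>
  have "lead_coeff q = 1" using degree_monic_char_poly[OF mB] by (simp add: q_def)
  with poly_pinfty_gt_lc[of q] obtain M where M: "\<And>s. M \<le> s \<Longrightarrow> 1 \<le> poly q s" by auto
  have "poly q 0 < 0" using \<open>\<not> 0 < det B\<close> no_root[of 0] q0 by simp
  moreover have "0 < poly q (max M 1)" using M[of "max M 1"] by simp
  ultimately obtain s where "0 < s" "poly q s = 0"
    using poly_IVT_pos[of 0 "max M 1" q] by (auto simp: less_max_iff_disj)
  with no_root show False by simp
qed

lemma pow_mat_Suc_left:
  fixes A :: "'a :: semiring_1 mat"
  assumes A: "A \<in> carrier_mat n n"
  shows "A ^\<^sub>m Suc k = A * A ^\<^sub>m k"
proof (induction k)
  case (Suc k)
  have "A ^\<^sub>m Suc (Suc k) = A * A ^\<^sub>m k * A" using Suc by simp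
  also have "\<dots> = A * (A ^\<^sub>m k * A)" using A by (intro assoc_mult_mat[of _ n n _ n _ n]) auto
  finally show ?case by simp
qed (use A in simp)

text \<open>This is the lower Collatz-Wielandt bound. If it failed, scaling \<open>P\<close> by a
  number between its spectral radius and \<open>r\<close> would give a matrix with bounded powers
  that nevertheless expands \<open>a\<close> geometrically.\<close>

lemma spectral_radius_ge_subinvariant:
  fixes P :: "real mat" and a :: "nat \<Rightarrow> real"
  assumes P: "P \<in> carrier_mat n n" and P0: "\<And>i j. i < n \<Longrightarrow> j < n \<Longrightarrow> 0 \<le> P $$ (i, j)"
    and a: "\<And>i. i < n \<Longrightarrow> 0 \<le> a i" "\<exists>i<n. 0 < a i"
    and sub: "\<And>i. i < n \<Longrightarrow> r * a i \<le> (\<Sum>j<n. P $$ (i, j) * a j)"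
  shows "r \<le> spectral_radius (map_mat complex_of_real P)" (is "_ \<le> ?\<rho>")
proof (rule ccontr)
  assume less: "\<not> ?thesis"
  define \<mu> where "\<mu> = (?\<rho> + r) / 2"
  define Q where "Q = (1 / \<mu>) \<cdot>\<^sub>m P"
  define av where "av = vec n a"
  define Pc where "Pc = map_mat complex_of_real P"
  define Qc where "Qc = map_mat complex_of_real Q"
  have n: "0 < n" using a(2) by auto
  have Q: "Q \<in> carrier_mat n n" and Pc: "Pc \<in> carrier_mat n n" and Qc: "Qc \<in> carrier_mat n n"
    using P by (auto simp: Q_def Pc_def Qc_def)
  have "0 \<le> ?\<rho>" using spectral_radius_mem_max(1)[OF Pc n] unfolding Pc_def by auto
  then have \<mu>: "?\<rho> < \<mu>" "\<mu> < r" "0 < \<mu>" using less by (auto simp: \<mu>_def)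
  have "spectral_radius Qc < 1"
  proof -
    obtain ev u where ev: "spectral_radius Qc = norm ev" and u: "eigenvector Qc u ev"
      using spectral_radius_mem_max(1)[OF Qc n] by (auto simp: spectrum_def eigenvalue_def)
    then have uc: "u \<in> carrier_vec n" using Qc by (simp add: eigenvector_def)
    have "Pc = complex_of_real \<mu> \<cdot>\<^sub>m Qc"
      by (rule eq_matI) (use P \<mu> in \<open>auto simp: Pc_def Qc_def Q_def\<close>)
    then have "Pc *\<^sub>v u = complex_of_real \<mu> \<cdot>\<^sub>v (Qc *\<^sub>v u)"
      using Qc uc by (intro eq_vecI) (auto simp: scalar_prod_def sum_distrib_left mult.assoc)
    also have "\<dots> = (complex_of_real \<mu> * ev) \<cdot>\<^sub>v u"
      using u by (auto simp: eigenvector_def smult_smult_assoc)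
    finally have "eigenvector Pc u (complex_of_real \<mu> * ev)"
      using u Pc Qc by (auto simp: eigenvector_def)
    then have "norm (complex_of_real \<mu> * ev) \<le> ?\<rho>"
      using spectral_radius_mem_max(2)[OF Pc n] unfolding spectrum_def eigenvalue_def Pc_def by blast
    moreover have "norm (complex_of_real \<mu> * ev) = \<mu> * norm ev" using \<mu> by (simp add: norm_mult)
    ultimately have "\<mu> * norm ev < \<mu>" using \<mu> by linarith
    then show ?thesis using \<mu> by (simp add: ev)
  qed
  \<comment> \<open>Strictness gives one bound for all powers; at spectral radius 1, nontrivial
    Jordan blocks could make them grow.\<close>
  from spectral_radius_jnf_norm_bound_less_1_upper_triangular[OF Qc this]
  obtain c where c: "\<And>k. norm_bound (Qc ^\<^sub>m k) c" by blast
  have Qk: "Q ^\<^sub>m k \<in> carrier_mat n n" for k using Q by simp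
  have bound: "(Q ^\<^sub>m k) $$ (i, j) \<le> c" if "i < n" "j < n" for i j k
  proof -
    have "Qc ^\<^sub>m k = map_mat complex_of_real (Q ^\<^sub>m k)"
      unfolding Qc_def by (rule of_real_hom.mat_hom_pow[OF Q, symmetric])
    with c[of k] that Q have "\<bar>(Q ^\<^sub>m k) $$ (i, j)\<bar> \<le> c"
      by (auto simp: norm_bound_def split: if_splits)
    then show ?thesis by simp
  qed
  \<comment> \<open>Nonnegativity of \<open>Q\<close> lets the inequality
    \<open>Q a \<ge> (r / \<mu>) a\<close> be iterated; the ratio exceeds 1.\<close>
  have growth: "(r / \<mu>) ^ k * a i \<le> (Q ^\<^sub>m k *\<^sub>v av) $ i" if "i < n" for i k
    using that
  proof (induction k arbitrary: i)
    case 0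
    then show ?case using Q by (simp add: av_def)
  next
    case (Suc k)
    have "(r / \<mu>) ^ Suc k * a i = (r / \<mu>) ^ k / \<mu> * (r * a i)" by simp
    also have "\<dots> \<le> (r / \<mu>) ^ k / \<mu> * (\<Sum>j<n. P $$ (i, j) * a j)"
      using sub[OF Suc.prems] \<mu> by (intro mult_left_mono) auto
    also have "\<dots> = (\<Sum>j<n. Q $$ (i, j) * ((r / \<mu>) ^ k * a j))"
      unfolding sum_distrib_left using P Suc.prems by (intro sum.cong) (auto simp: Q_def)
    also have "\<dots> \<le> (\<Sum>j<n. Q $$ (i, j) * (Q ^\<^sub>m k *\<^sub>v av) $ j)"
      using Suc P P0 \<mu> by (intro sum_mono mult_left_mono) (auto simp: Q_def)
    also have "\<dots> = (Q *\<^sub>v (Q ^\<^sub>m k *\<^sub>v av)) $ i"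
      using Q Qk[of k] Suc.prems
      by (simp add: mult_mat_vec_def scalar_prod_def av_def atLeast0LessThan)
    also have "Q *\<^sub>v (Q ^\<^sub>m k *\<^sub>v av) = (Q * Q ^\<^sub>m k) *\<^sub>v av"
      using Q Qk[of k] by (simp add: av_def assoc_mult_mat_vec[of _ n n _ n])
    also have "Q * Q ^\<^sub>m k = Q ^\<^sub>m Suc k" by (rule pow_mat_Suc_left[OF Q, symmetric])
    finally show ?case .
  qed
  obtain i where i: "i < n" "0 < a i" using a(2) by blast
  define C where "C = c * (\<Sum>j<n. a j)"
  have "(r / \<mu>) ^ k \<le> C / a i" for k
  proof -
    have "(r / \<mu>) ^ k * a i \<le> (Q ^\<^sub>m k *\<^sub>v av) $ i" by (rule growth[OF i(1)])
    also have "\<dots> = (\<Sum>j<n. (Q ^\<^sub>m k) $$ (i, j) * a j)"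
      using Q i by (simp add: scalar_prod_def av_def atLeast0LessThan)
    also have "\<dots> \<le> C"
      unfolding C_def sum_distrib_left using bound i a by (intro sum_mono mult_right_mono) auto
    finally show ?thesis using i by (simp add: field_simps)
  qed
  moreover obtain k where "C / a i < (r / \<mu>) ^ k"
    using real_arch_pow[of "r / \<mu>" "C / a i"] \<mu> by auto
  ultimately show False by (meson not_le)
qed

section \<open>Application to principal submatrices of the perturbed M-matrix\<close>

theorem proposition2p19:
  fixes n :: nat and A :: "real mat" and z\<^sub>l z\<^sub>r v w :: "real vec"
  assumes "A \<in> carrier_mat n n"
    and "singular_M_matrix n A"
    and "irreducible_mat n A"
    and "eigenvector (transpose_mat A) z\<^sub>l 0"
    and "eigenvector A z\<^sub>r 0"
    and "v \<in> carrier_vec n" and "w \<in> carrier_vec n"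
    and "0\<^sub>v n \<le> v" and "0\<^sub>v n \<le> w"
    and "(z\<^sub>l \<bullet> v) * (w \<bullet> z\<^sub>r) \<noteq> 0"
  shows "P_matrix n (A + outer_prod v w)"
proof -
  note A = assms(1) and v = assms(6) and w = assms(7)
  obtain \<gamma> P where P: "P \<in> carrier_mat n n" "0\<^sub>m n n \<le> P" "A = \<gamma> \<cdot>\<^sub>m 1\<^sub>m n - P"
    and \<gamma>: "\<gamma> = spectral_radius (map_mat complex_of_real P)"
    using assms(2) by (auto simp: singular_M_matrix_def M_matrix_rep_def)
  define p where "p i j = P $$ (i, j)" for i j
  have p0: "0 \<le> p i j" if "i < n" "j < n" for i j
    using P(1,2) that by (auto simp: less_eq_mat_def p_def)
  have A_p: "A $$ (i, j) = (if i = j then \<gamma> else 0) - p i j" if "i < n" "j < n" for i j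
    using that P by (auto simp: p_def)
  have zr: "z\<^sub>r \<in> carrier_vec n" "z\<^sub>r \<noteq> 0\<^sub>v n" "A *\<^sub>v z\<^sub>r = 0 \<cdot>\<^sub>v z\<^sub>r"
    and zl: "z\<^sub>l \<in> carrier_vec n"
    using assms(1,4,5) by (auto simp: eigenvector_def)
  have zr_ne: "\<exists>i<n. z\<^sub>r $ i \<noteq> 0" using zr by (metis carrier_vecD eq_vecI index_zero_vec)
  then have n: "0 < n" by auto
  interpret irreducible_nonneg "{..<n}" p
  proof
    fix Z assume Z: "Z \<subseteq> {..<n}" "Z \<noteq> {}"
      "\<And>i j. i \<in> Z \<Longrightarrow> j \<in> {..<n} \<Longrightarrow> p i j \<noteq> 0 \<Longrightarrow> j \<in> Z"
    show "Z = {..<n}"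
    proof (rule irreducible_mat_closed_set[OF assms(3) Z(1,2)])
      fix i j assume ij: "i \<in> Z" "j < n" "j \<notin> Z"
      \<comment> \<open>Off the diagonal \<open>A\<close> equals \<open>- P\<close>, so
        irreducibility passes from \<open>A\<close> to \<open>p\<close>.\<close>
      then have "p i j = 0" "i < n" "i \<noteq> j" using Z(1) Z(3)[of i j] by auto
      then show "A $$ (i, j) = 0" using A_p[of i j] ij by simp
    qed
  qed (use p0 in auto)
  define x where "x i = \<bar>z\<^sub>r $ i\<bar>" for i
  have Pz: "(\<Sum>j<n. p i j * z\<^sub>r $ j) = \<gamma> * z\<^sub>r $ i" if "i < n" for i
  proof -
    have "0 = (A *\<^sub>v z\<^sub>r) $ i" using zr that by simp
    also have "\<dots> = (\<Sum>j<n. A $$ (i, j) * z\<^sub>r $ j)"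
      using A zr(1) that by (simp add: scalar_prod_def atLeast0LessThan)
    also have "\<dots> = (\<Sum>j<n. (if i = j then \<gamma> * z\<^sub>r $ j else 0) - p i j * z\<^sub>r $ j)"
      using that by (intro sum.cong) (auto simp: A_p algebra_simps)
    also have "\<dots> = \<gamma> * z\<^sub>r $ i - (\<Sum>j<n. p i j * z\<^sub>r $ j)"
      using that by (simp add: sum_subtractf)
    finally show ?thesis by simp
  qed
  have "0 \<le> \<gamma>"
    using spectral_radius_mem_max(1)[of "map_mat complex_of_real P" n] P(1) n unfolding \<gamma> by auto
  have sub: "\<gamma> * x i \<le> (\<Sum>j\<in>{..<n}. p i j * x j)" if "i \<in> {..<n}" for i
  proof -
    have "\<gamma> * x i = \<bar>\<Sum>j<n. p i j * z\<^sub>r $ j\<bar>"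
      using Pz[of i] that \<open>0 \<le> \<gamma>\<close> by (simp add: x_def abs_mult)
    also have "\<dots> \<le> (\<Sum>j<n. \<bar>p i j * z\<^sub>r $ j\<bar>)" by (rule sum_abs)
    also have "\<dots> = (\<Sum>j<n. p i j * x j)"
      using p0 that by (intro sum.cong) (auto simp: x_def abs_mult)
    finally show ?thesis .
  qed
  \<comment> \<open>Singularity enters here: \<gamma> equals the spectral radius of
    \<open>P\<close>, so no larger factor is possible.\<close>
  have maximal: "r \<le> \<gamma>" if "\<And>i. i \<in> {..<n} \<Longrightarrow> 0 \<le> c i" "\<exists>i\<in>{..<n}. 0 < c i"
    "\<And>i. i \<in> {..<n} \<Longrightarrow> r * c i \<le> (\<Sum>j\<in>{..<n}. p i j * c j)" for c r
    unfolding \<gamma> by (rule spectral_radius_ge_subinvariant[OF P(1), of c])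
      (use that p0 in \<open>auto simp: p_def\<close>)
  have x0: "\<And>i. i \<in> {..<n} \<Longrightarrow> 0 \<le> x i" "\<exists>i\<in>{..<n}. x i \<noteq> 0"
    using zr_ne by (auto simp: x_def)
  have x_pos: "0 < x i" if "i \<in> {..<n}" for i
    by (rule subinvariant_imp_positive_invariant(1)[of \<gamma> x])
      (fact \<open>0 \<le> \<gamma>\<close> x0 sub maximal that)+
  have Px: "(\<Sum>j\<in>{..<n}. p i j * x j) = \<gamma> * x i" if "i \<in> {..<n}" for i
    by (rule subinvariant_imp_positive_invariant(2)[of \<gamma> x])
      (fact \<open>0 \<le> \<gamma>\<close> x0 sub maximal that)+
  have v0: "\<And>i. i \<in> {..<n} \<Longrightarrow> 0 \<le> v $ i" and w0: "\<And>i. i \<in> {..<n} \<Longrightarrow> 0 \<le> w $ i"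
    using assms(6-9) by (auto simp: less_eq_vec_def)
  \<comment> \<open>The nonzero product of scalar products excludes \<open>v = 0\<close> and, below,
    \<open>w = 0\<close>.\<close>
  have v1: "\<exists>i\<in>{..<n}. v $ i \<noteq> 0"
  proof (rule ccontr)
    assume "\<not> ?thesis"
    then have "z\<^sub>l \<bullet> v = 0" using v by (simp add: scalar_prod_def)
    with assms(10) show False by simp
  qed
  have w1: "\<exists>i\<in>{..<n}. w $ i \<noteq> 0"
  proof (rule ccontr)
    assume "\<not> ?thesis"
    then have "w \<bullet> z\<^sub>r = 0" using zr by (simp add: scalar_prod_def)
    with assms(10) show False by simp
  qed
  define B where "B = A + outer_prod v w"
  have B: "B \<in> carrier_mat n n" using A v w by (auto simp: B_def outer_prod_def)
  have "0 < det (submatrix B I I)" if I: "I \<subseteq> {..<n}" for I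
  proof -
    have cardI: "{i. i < n \<and> i \<in> I} = I" using I by auto
    define m where "m = card I"
    define S where "S = submatrix B I I"
    have fin: "finite I" using I finite_subset by blast
    have S: "S \<in> carrier_mat m m" using B by (auto simp: S_def m_def dim_submatrix cardI)
    have "inj_on (pick I) {..<m}"
      by (rule inj_onI) (metis lessThan_iff linorder_neqE_nat m_def order_less_irrefl pick_mono_le)
    moreover have sub_I: "pick I ` {..<m} \<subseteq> I" by (auto simp: m_def intro: pick_in_set_le)
    ultimately have bij: "bij_betw (pick I) {..<m} I"
      unfolding bij_betw_def using fin by (simp add: card_image card_subset_eq m_def)
    \<comment> \<open>\<open>pick I\<close> lists \<open>I\<close> in increasing order and
      \<open>g\<close> is its inverse; they carry vectors between positions below \<open>m\<close>
      and the original indices in \<open>I\<close>.\<close>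
    define g where "g = inv_into {..<m} (pick I)"
    have g: "g (pick I i) = i" if "i < m" for i
      using bij that by (simp add: g_def bij_betw_inv_into_left)
    have S_ij: "S $$ (i, j) = B $$ (pick I i, pick I j)" if "i < m" "j < m" for i j
      using that B unfolding S_def by (intro submatrix_index) (auto simp: m_def cardI)
    have "0 < det S"
    proof (rule det_pos_if_real_eigenvalues_pos[OF S], rule ccontr)
      fix k assume "eigenvalue S k" and "\<not> 0 < k"
      then have k: "k \<le> 0" by simp
      from \<open>eigenvalue S k\<close> obtain u where u: "u \<in> carrier_vec m" "u \<noteq> 0\<^sub>v m" "S *\<^sub>v u = k \<cdot>\<^sub>v u"
        using S by (auto simp: eigenvalue_def eigenvector_def)
      define u' where "u' i = u $ g i" for i
      \<comment> \<open>The eigenvalue equation of the submatrix, reindexed over \<open>I\<close>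
        and split into its \<gamma>, \<open>p\<close> and rank-one parts, has the shape required by
        \<open>rank_one_perturbation_eq_0\<close>.\<close>
      have eq: "\<gamma> * u' i - (\<Sum>j\<in>I. p i j * u' j) + v $ i * (\<Sum>j\<in>I. w $ j * u' j) = k * u' i"
        if i: "i \<in> I" for i
      proof -
        have g_i: "g i < m" "pick I (g i) = i"
          using bij i by (auto simp: g_def bij_betw_inv_into_right bij_betw_def
            intro: inv_into_into[of i "pick I" "{..<m}", simplified])
        have "k * u' i = (S *\<^sub>v u) $ g i" using u g_i by (simp add: u'_def)
        also have "\<dots> = (\<Sum>j<m. S $$ (g i, j) * u $ j)"
          using S u(1) g_i by (simp add: scalar_prod_def atLeast0LessThan)
        also have "\<dots> = (\<Sum>j<m. B $$ (i, pick I j) * u' (pick I j))"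
          using g_i by (intro sum.cong) (auto simp: S_ij u'_def g)
        also have "\<dots> = (\<Sum>j\<in>I. B $$ (i, j) * u' j)"
          by (rule sum.reindex_bij_betw[OF bij])
        also have "\<dots> = (\<Sum>j\<in>I. (if i = j then \<gamma> * u' j else 0) - p i j * u' j
            + v $ i * (w $ j * u' j))"
          using i I A v w
          by (intro sum.cong) (auto simp: B_def outer_prod_def A_p algebra_simps subset_iff)
        also have "\<dots> = \<gamma> * u' i - (\<Sum>j\<in>I. p i j * u' j) + v $ i * (\<Sum>j\<in>I. w $ j * u' j)"
          using i fin by (simp add: sum.distrib sum_subtractf sum_distrib_left)
        finally show ?thesis by simp
      qed
      have "u' i = 0" if "i \<in> I" for i
        by (rule rank_one_perturbation_eq_0[OF x_pos _ I k v0 v1 w0 w1 eq that])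
          (use Px in auto)
      moreover have "u $ i = u' (pick I i)" "pick I i \<in> I" if "i < m" for i
        using g[OF that] sub_I that by (auto simp: u'_def)
      ultimately have "u = 0\<^sub>v m" using u(1) by (intro eq_vecI) auto
      with u(2) show False by simp
    qed
    then show ?thesis by (simp add: S_def)
  qed
  then show ?thesis using B by (simp add: P_matrix_def B_def)
qed

end
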